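(* Let $K\subset\mathbb{R}^d$ be a compact set or manifold and let $\mathcal{A}_n\subset K$ be a polynomial mesh for $K$ with constant $C$ and cardinality $M_n>N_{2n}=\dim(\mathbb{P}_{2n}^d(K))$. Let $\mu$ be the discrete measure with unit weights supported at $\mathcal{A}_n$, and let $T_{2n}=\{t_j\}_{1\leq j\leq m}\subseteq\mathcal{A}_n$, $m\leq N_{2n}$, be Caratheodory-Tchakaloff quadrature points for exactness degree $\nu=2n$ extracted from $\mathcal{A}_n$, with corresponding positive weights $\boldsymbol{w}=\{w_j\}_{1\leq j\leq m}$. For $f\in C(K)$ let $\mathcal{L}^w_{T_{2n}}f\in\mathbb{P}_n^d(K)$ be the weighted discrete least squares polynomial of $f$ on $T_{2n}$. Then $T_{2n}$ is a weakly admissible polynomial mesh for $K$ with $$C_n=C\sqrt{M_n},$$ and the following estimate holds for the corresponding weighted least squares approximation of every $f\in C(K)$: $$\|f-\mathcal{L}^w_{T_{2n}}f\|_{L^\infty(K)}\leq(1+C_n)\,\min_{p\in\mathbb{P}_n^d(K)}\|f-p\|_{L^\infty(K)}.$$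
   Context: $\mathbb{P}_n^d(K)$ denotes the space of restrictions to $K$ of real $d$-variate polynomials of total degree at most $n$, and $N_n=\dim\mathbb{P}_n^d(K)$. A polynomial mesh for $K$ with constant $C$ is a sequence of finite subsets $\mathcal{A}_n\subset K$ such that $\|p\|_{L^\infty(K)}\leq C\,\|p\|_{\ell^\infty(\mathcal{A}_n)}$ for all $p\in\mathbb{P}_n^d(K)$, with $C$ independent of $n$, and $M_n=\mathrm{card}(\mathcal{A}_n)=\mathcal{O}(N_n^\beta)$ for some $\beta\geq 1$. A weakly admissible polynomial mesh is defined in the same way with $C$ replaced by a sequence $C_n$ that grows at most subexponentially in $n$ (for instance $C_n=\mathcal{O}(n^s)$, $s\geq 0$). Caratheodory-Tchakaloff quadrature points for exactness degree $\nu$ extracted from $\mathcal{A}_n=\{x_i\}_{1\leq i\leq M_n}$ (with unit masses) are nodes $\{t_j\}_{1\leq j\leq m}\subseteq\mathcal{A}_n$, $m\leq\dim\mathbb{P}_\nu^d(\mathcal{A}_n)$, with positive weights $w_j$, such that $\sum_{i=1}^{M_n}p(x_i)=\sum_{j=1}^m w_j\,p(t_j)$ for all $p\in\mathbb{P}_\nu^d(\mathcal{A}_n)$; they exist by Tchakaloff's theorem. The polynomial $\mathcal{L}^w_{T_{2n}}f$ is defined by $\|f-\mathcal{L}^w_{T_{2n}}f\|_{\ell^2_{\boldsymbol{w}}(T_{2n})}=\min_{p\in\mathbb{P}_n^d(K)}\|f-p\|_{\ell^2_{\boldsymbol{w}}(T_{2n})}$, where $\|g\|^2_{\ell^2_{\boldsymbol{w}}(T_{2n})}=\sum_{j=1}^m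 w_j\,g(t_j)^2$. *)

theory Defs
  imports
    "HOL-Analysis.Analysis"
    "HOL-Library.Landau_Symbols"
    "HOL-Library.Function_Algebras"
begin

(* The pointwise real vector space structure on functions, so that the library's
   dim applies to spaces of functions. *)
instantiation "fun" :: (type, real_vector) real_vector
begin

definition scaleR_fun :: "real \<Rightarrow> ('a \<Rightarrow> 'b) \<Rightarrow> 'a \<Rightarrow> 'b"
  where "scaleR_fun c f = (\<lambda>x. c *\<^sub>R f x)"

instance
  by standard (simp_all add: scaleR_fun_def fun_eq_iff scaleR_right_distrib scaleR_left_distrib)

end

definition monomial_fun :: "('d::finite \<Rightarrow> nat) \<Rightarrow> real^'d \<Rightarrow> real"
  where "monomial_fun \<alpha> x = (\<Prod>i\<in>UNIV. (x $ i) ^ \<alpha> i)"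

definition multi_indices :: "nat \<Rightarrow> ('d::finite \<Rightarrow> nat) set"
  where "multi_indices n = {\<alpha>. (\<Sum>i\<in>UNIV. \<alpha> i) \<le> n}"

lemma finite_multi_indices: "finite (multi_indices n :: ('d::finite \<Rightarrow> nat) set)"
proof (rule finite_subset)
  show "multi_indices n \<subseteq> (Pi\<^sub>E UNIV (\<lambda>_. {..n}) :: ('d \<Rightarrow> nat) set)"
  proof
    fix \<alpha> :: "'d \<Rightarrow> nat" assume "\<alpha> \<in> multi_indices n"
    then have "\<alpha> i \<le> n" for i
      using member_le_sum[of i UNIV \<alpha>] by (auto simp: multi_indices_def)
    then show "\<alpha> \<in> Pi\<^sub>E UNIV (\<lambda>_. {..n})" by (auto simp: PiE_def)
  qed
qed (simp add: finite_PiE)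

(* A function on S is represented by its extension by zero to the whole space.
   Hence two polynomials that agree on S give the same element, and
   dim (poly_space n S) is the dimension of the space of restrictions to S. *)
definition poly_space :: "nat \<Rightarrow> (real^'d::finite) set \<Rightarrow> (real^'d \<Rightarrow> real) set"
  where "poly_space n S =
    {p. \<exists>c. p = (\<lambda>x. if x \<in> S then \<Sum>\<alpha>\<in>multi_indices n. c \<alpha> * monomial_fun \<alpha> x else 0)}"

(* The supremum norm on S, for functions bounded on S; inserting 0 only matters for
   empty S, where the norm is 0. *)
definition sup_norm :: "'a set \<Rightarrow> ('a \<Rightarrow> real) \<Rightarrow> real"
  where "sup_norm S g = Sup (insert 0 ((\<lambda>x. \<bar>g x\<bar>) ` S))"

definition norming_mesh ::
    "(real^'d::finite) set \<Rightarrow> (nat \<Rightarrow> (real^'d) set) \<Rightarrow> (nat \<Rightarrow> real) \<Rightarrow> bool"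
  where "norming_mesh K A C \<longleftrightarrow>
    (\<forall>n. finite (A n) \<and> A n \<subseteq> K \<and>
         (\<forall>p\<in>poly_space n K. sup_norm K p \<le> C n * sup_norm (A n) p)) \<and>
    (\<exists>\<beta>::real. \<beta> \<ge> 1 \<and>
         (\<lambda>n. real (card (A n))) \<in> O(\<lambda>n. real (dim (poly_space n K)) powr \<beta>))"

definition polynomial_mesh ::
    "(real^'d::finite) set \<Rightarrow> (nat \<Rightarrow> (real^'d) set) \<Rightarrow> real \<Rightarrow> bool"
  where "polynomial_mesh K A C \<longleftrightarrow> norming_mesh K A (\<lambda>_. C)"

definition subexponential :: "(nat \<Rightarrow> real) \<Rightarrow> bool"
  where "subexponential C \<longleftrightarrow> (\<forall>\<epsilon>>0. C \<in> O(\<lambda>n. exp (\<epsilon> * real n)))"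

definition weakly_admissible_mesh ::
    "(real^'d::finite) set \<Rightarrow> (nat \<Rightarrow> (real^'d) set) \<Rightarrow> (nat \<Rightarrow> real) \<Rightarrow> bool"
  where "weakly_admissible_mesh K A C \<longleftrightarrow> norming_mesh K A C \<and> subexponential C"

(* Nodes T and weights w for the measure with unit masses on X; the weight of a node t is w t,
   and values of w outside T are irrelevant. *)
definition caratheodory_tchakaloff ::
    "(real^'d::finite) set \<Rightarrow> nat \<Rightarrow> (real^'d) set \<Rightarrow> (real^'d \<Rightarrow> real) \<Rightarrow> bool"
  where "caratheodory_tchakaloff X \<nu> T w \<longleftrightarrow>
    finite X \<and> T \<subseteq> X \<and> card T \<le> dim (poly_space \<nu> X) \<and> (\<forall>t\<in>T. w t > 0) \<and>
    (\<forall>p\<in>poly_space \<nu> X. (\<Sum>x\<in>X. p x) = (\<Sum>t\<in>T. w t * p t))"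

definition weighted_l2_norm :: "'a set \<Rightarrow> ('a \<Rightarrow> real) \<Rightarrow> ('a \<Rightarrow> real) \<Rightarrow> real"
  where "weighted_l2_norm T w g = sqrt (\<Sum>t\<in>T. w t * (g t)\<^sup>2)"

(* The least squares polynomial, meaningful when the minimiser is unique in poly_space n K. *)
definition wls_poly ::
    "(real^'d::finite) set \<Rightarrow> nat \<Rightarrow> (real^'d) set \<Rightarrow> (real^'d \<Rightarrow> real) \<Rightarrow>
     (real^'d \<Rightarrow> real) \<Rightarrow> real^'d \<Rightarrow> real"
  where "wls_poly K n T w f =
    (THE q. is_arg_min (\<lambda>p. weighted_l2_norm T w (f - p)) (\<lambda>p. p \<in> poly_space n K) q)"

end

theory Submission
  imports Defs "HOL-Real_Asymp.Real_Asymp"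
begin

text \<open>The quadrature formula is exact on squares of polynomials of degree \<open>n\<close>, so
  the weighted norm on the nodes coincides on these polynomials with the plain \<open>\<ell>\<^sup>2\<close> norm on the
  mesh, which dominates the maximum norm on the mesh; and it is at most
  \<open>sqrt M\<^sub>n\<close> times the maximum norm on the nodes, the weights having sum \<open>M\<^sub>n\<close>
  by exactness on constants.  The error estimate follows because the least squares polynomial is
  an orthogonal projection, hence contracts the weighted norm and reproduces polynomials.\<close>

section \<open>The supremum norm\<close>

text \<open>\<open>Sup\<close> bounds a set of reals from above only if the set is bounded above,
  hence the assumption here and in later uses; on compact sets continuity supplies it.\<close>

lemma sup_norm_upper:
  assumes "bdd_above ((\<lambda>x. \<bar>g x\<bar>) ` S)" and "x \<in> S"
  shows "\<bar>g x\<bar> \<le> sup_norm S g"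
  unfolding sup_norm_def using assms by (intro cSup_upper) auto

lemma sup_norm_nonneg:
  assumes "bdd_above ((\<lambda>x. \<bar>g x\<bar>) ` S)"
  shows "0 \<le> sup_norm S g"
  unfolding sup_norm_def using assms by (intro cSup_upper) auto

lemma sup_norm_least:
  assumes "0 \<le> B" and "\<And>x. x \<in> S \<Longrightarrow> \<bar>g x\<bar> \<le> B"
  shows "sup_norm S g \<le> B"
  unfolding sup_norm_def using assms by (intro cSup_least) auto

lemma continuous_on_compact_bdd_abs:
  fixes g :: "'a::topological_space \<Rightarrow> real"
  assumes "compact S" and "continuous_on S g"
  shows "bdd_above ((\<lambda>x. \<bar>g x\<bar>) ` S)"
  using assms
  by (intro bounded_imp_bdd_above compact_imp_bounded compact_continuous_image continuous_intros)

section \<open>Polynomial spaces\<close>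

text \<open>The extension by zero matches the encoding of \<open>poly_space\<close>, which thereby
  becomes a span in the space of all functions, so that \<open>span\<close> and \<open>dim\<close>
  apply.\<close>

definition restricted_monomial ::
    "(real^'d::finite) set \<Rightarrow> ('d \<Rightarrow> nat) \<Rightarrow> real^'d \<Rightarrow> real"
  where "restricted_monomial S \<alpha> = (\<lambda>x. if x \<in> S then monomial_fun \<alpha> x else 0)"

lemma sum_fun_apply: "(\<Sum>i\<in>I. F i) x = (\<Sum>i\<in>I. F i x)"
  by (induction I rule: infinite_finite_induct) auto

lemma poly_space_eq_linear_combinations:
  "poly_space n S = {p. \<exists>c. p = (\<Sum>\<alpha>\<in>multi_indices n. c \<alpha> *\<^sub>R restricted_monomial S \<alpha>)}"
proof -
  have "(\<Sum>\<alpha>\<in>multi_indices n. c \<alpha> *\<^sub>R restricted_monomial S \<alpha>) =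
      (\<lambda>x. if x \<in> S then \<Sum>\<alpha>\<in>multi_indices n. c \<alpha> * monomial_fun \<alpha> x else 0)" for c
    by (rule ext) (auto simp: sum_fun_apply scaleR_fun_def restricted_monomial_def)
  then show ?thesis
    unfolding poly_space_def by simp
qed

lemma restricted_monomial_in_poly_space:
  assumes "\<alpha> \<in> multi_indices n"
  shows "restricted_monomial S \<alpha> \<in> poly_space n S"
proof -
  have "(\<Sum>\<beta>\<in>multi_indices n. (if \<beta> = \<alpha> then 1 else 0) *\<^sub>R restricted_monomial S \<beta>)
      = (\<Sum>\<beta>\<in>multi_indices n. if \<beta> = \<alpha> then restricted_monomial S \<beta> else 0)"
    by (rule sum.cong) auto
  then have "(\<Sum>\<beta>\<in>multi_indices n. (if \<beta> = \<alpha> then 1 else 0) *\<^sub>R restricted_monomial S \<beta>)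
      = restricted_monomial S \<alpha>"
    using assms by (simp add: finite_multi_indices)
  then show ?thesis
    unfolding poly_space_eq_linear_combinations mem_Collect_eq by metis
qed

lemma subspace_poly_space: "subspace (poly_space n S)"
proof (rule subspaceI)
  show "0 \<in> poly_space n S"
    unfolding poly_space_eq_linear_combinations mem_Collect_eq by (intro exI[of _ "\<lambda>_. 0"]) simp
next
  fix p q assume "p \<in> poly_space n S" "q \<in> poly_space n S"
  then obtain a b where "p = (\<Sum>\<alpha>\<in>multi_indices n. a \<alpha> *\<^sub>R restricted_monomial S \<alpha>)"
      "q = (\<Sum>\<alpha>\<in>multi_indices n. b \<alpha> *\<^sub>R restricted_monomial S \<alpha>)"
    unfolding poly_space_eq_linear_combinations by auto
  then show "p + q \<in> poly_space n S"
    unfolding poly_space_eq_linear_combinations mem_Collect_eq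
    by (intro exI[of _ "\<lambda>\<alpha>. a \<alpha> + b \<alpha>"]) (simp add: scaleR_left_distrib sum.distrib)
next
  fix r p assume "p \<in> poly_space n S"
  then obtain a where "p = (\<Sum>\<alpha>\<in>multi_indices n. a \<alpha> *\<^sub>R restricted_monomial S \<alpha>)"
    unfolding poly_space_eq_linear_combinations by auto
  then show "r *\<^sub>R p \<in> poly_space n S"
    unfolding poly_space_eq_linear_combinations mem_Collect_eq
    by (intro exI[of _ "\<lambda>\<alpha>. r * a \<alpha>"]) (simp add: scaleR_sum_right)
qed

text \<open>The finite spanning set serves the dimension bound and the induction that builds
  projections. On a small S the restricted monomials may be dependent or even coincide, so they are
  not treated as a basis.\<close>

lemma poly_space_eq_span: "poly_space n S = span (restricted_monomial S ` multi_indices n)"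
proof
  show "poly_space n S \<subseteq> span (restricted_monomial S ` multi_indices n)"
    unfolding poly_space_eq_linear_combinations
    by (clarify, intro span_sum span_scale span_base imageI)
  show "span (restricted_monomial S ` multi_indices n) \<subseteq> poly_space n S"
    by (intro span_minimal subspace_poly_space image_subsetI restricted_monomial_in_poly_space)
qed

text \<open>Each exponent is at most n, so the indices lie in a box. This crude count suffices for
  growth that is polynomial in n.\<close>

lemma card_multi_indices_le:
  "card (multi_indices n :: ('d::finite \<Rightarrow> nat) set) \<le> (n + 1) ^ CARD('d)"
proof -
  have "multi_indices n \<subseteq> (Pi\<^sub>E UNIV (\<lambda>_. {..n}) :: ('d \<Rightarrow> nat) set)"
  proof
    fix \<alpha> :: "'d \<Rightarrow> nat" assume "\<alpha> \<in> multi_indices n"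
    then have "\<alpha> i \<le> n" for i
      using member_le_sum[of i UNIV \<alpha>] by (auto simp: multi_indices_def)
    then show "\<alpha> \<in> Pi\<^sub>E UNIV (\<lambda>_. {..n})" by auto
  qed
  then have "card (multi_indices n :: ('d \<Rightarrow> nat) set)
      \<le> card (Pi\<^sub>E UNIV (\<lambda>_. {..n}) :: ('d \<Rightarrow> nat) set)"
    by (intro card_mono finite_PiE) auto
  then show ?thesis by (simp add: card_PiE)
qed

lemma dim_poly_space_le:
  fixes S :: "(real^'d::finite) set"
  shows "dim (poly_space n S) \<le> (n + 1) ^ CARD('d)"
proof -
  have "dim (poly_space n S) \<le> card (restricted_monomial S ` multi_indices n)"
    by (intro dim_le_card) (simp_all add: poly_space_eq_span finite_multi_indices)
  also have "\<dots> \<le> card (multi_indices n :: ('d \<Rightarrow> nat) set)"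
    by (rule card_image_le[OF finite_multi_indices])
  also have "\<dots> \<le> (n + 1) ^ CARD('d)"
    by (rule card_multi_indices_le)
  finally show ?thesis .
qed

lemma poly_space_outside:
  assumes "p \<in> poly_space n S" and "x \<notin> S"
  shows "p x = 0"
  using assms unfolding poly_space_def by auto

text \<open>Continuity holds relative to S; the extension by zero may jump at the boundary.\<close>

lemma poly_space_continuous_on:
  assumes "p \<in> poly_space n S"
  shows "continuous_on S p"
proof -
  obtain c where c: "p = (\<lambda>x. if x \<in> S then \<Sum>\<alpha>\<in>multi_indices n. c \<alpha> * monomial_fun \<alpha> x else 0)"
    using assms unfolding poly_space_def by auto
  have "continuous_on S (\<lambda>x. \<Sum>\<alpha>\<in>multi_indices n. c \<alpha> * monomial_fun \<alpha> x)"
    unfolding monomial_fun_def by (intro continuous_intros)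
  then show ?thesis
    by (rule continuous_on_eq) (simp add: c)
qed

lemma one_in_poly_space: "(\<lambda>x::real^'d::finite. if x \<in> S then 1 else 0) \<in> poly_space n S"
proof -
  have "restricted_monomial S (\<lambda>_::'d. 0) \<in> poly_space n S"
    by (rule restricted_monomial_in_poly_space) (simp add: multi_indices_def)
  moreover have "restricted_monomial S (\<lambda>_. 0) = (\<lambda>x. if x \<in> S then 1 else 0)"
    by (auto simp: restricted_monomial_def monomial_fun_def)
  ultimately show ?thesis by simp
qed

text \<open>The factors live on K and the product on a subset S, because squares of polynomials on K
  have to be tested in a quadrature formula that is exact on the mesh.\<close>

lemma poly_space_mult:
  assumes "p \<in> poly_space m K" and "q \<in> poly_space n K" and "S \<subseteq> K"
  shows "(\<lambda>x. if x \<in> S then p x * q x else 0) \<in> poly_space (m + n) S"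
proof -
  obtain a where a: "p = (\<lambda>x. if x \<in> K then \<Sum>\<alpha>\<in>multi_indices m. a \<alpha> * monomial_fun \<alpha> x else 0)"
    using assms(1) unfolding poly_space_def by auto
  obtain b where b: "q = (\<lambda>x. if x \<in> K then \<Sum>\<beta>\<in>multi_indices n. b \<beta> * monomial_fun \<beta> x else 0)"
    using assms(2) unfolding poly_space_def by auto
  have mult: "monomial_fun (\<alpha> + \<beta>) x = monomial_fun \<alpha> x * monomial_fun \<beta> x" for \<alpha> \<beta> and x :: "real^'a"
    by (simp add: monomial_fun_def power_add prod.distrib)
  have "(\<lambda>x. if x \<in> S then p x * q x else 0) =
      (\<Sum>\<alpha>\<in>multi_indices m. \<Sum>\<beta>\<in>multi_indices n. (a \<alpha> * b \<beta>) *\<^sub>R restricted_monomial S (\<alpha> + \<beta>))"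
  proof
    fix x
    show "(if x \<in> S then p x * q x else 0) =
      (\<Sum>\<alpha>\<in>multi_indices m. \<Sum>\<beta>\<in>multi_indices n. (a \<alpha> * b \<beta>) *\<^sub>R restricted_monomial S (\<alpha> + \<beta>)) x"
      using assms(3)
      by (auto simp: sum_fun_apply scaleR_fun_def restricted_monomial_def a b mult sum_product
          algebra_simps intro!: sum.cong)
  qed
  moreover have "\<alpha> + \<beta> \<in> multi_indices (m + n)"
    if "\<alpha> \<in> multi_indices m" "\<beta> \<in> multi_indices n" for \<alpha> \<beta> :: "'a \<Rightarrow> nat"
    using that by (auto simp: multi_indices_def sum.distrib)
  ultimately show ?thesis
    by (auto intro!: subspace_sum subspace_scale subspace_poly_space
        restricted_monomial_in_poly_space)
qed

section \<open>Weighted least squares\<close>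

text \<open>A Gram-Schmidt step for each element of B. The induction keeps f arbitrary, since the
  projections of both f and the new element b onto the old span are needed. The weighted form is
  only semidefinite on functions, so uniqueness is not claimed.\<close>

lemma weighted_projection_exists:
  fixes f :: "'a \<Rightarrow> real"
  assumes "finite T" and "\<And>t. t \<in> T \<Longrightarrow> w t > 0" and "finite B"
  shows "\<exists>p\<in>span B. \<forall>q\<in>span B. (\<Sum>t\<in>T. w t * (f t - p t) * q t) = 0"
  using assms(3)
proof (induction B arbitrary: f rule: finite_induct)
  case empty
  then show ?case by auto
next
  case (insert b B)
  obtain p where p: "p \<in> span B" "\<And>q. q \<in> span B \<Longrightarrow> (\<Sum>t\<in>T. w t * (f t - p t) * q t) = 0"
    using insert.IH[of f] by auto
  obtain r where r: "r \<in> span B" "\<And>q. q \<in> span B \<Longrightarrow> (\<Sum>t\<in>T. w t * (b t - r t) * q t) = 0"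
    using insert.IH[of b] by auto
  \<comment> \<open>\<open>b - r\<close> is the part of b orthogonal to the old span, N its squared
    weighted norm, and c the coefficient of \<open>f - p\<close> along it. If N = 0, division by
    zero gives c = 0.\<close>
  define N where "N = (\<Sum>t\<in>T. w t * (b t - r t)\<^sup>2)"
  define c where "c = (\<Sum>t\<in>T. w t * (f t - p t) * (b t - r t)) / N"
  define P where "P = p + c *\<^sub>R (b - r)"
  \<comment> \<open>In the degenerate case b and r agree on T, since the weights are positive; the
    residual is then already orthogonal to \<open>b - r\<close> and c = 0 is the right
    choice.\<close>
  have zero: "(\<Sum>t\<in>T. w t * (f t - p t) * (b t - r t)) = 0" if "N = 0"
  proof -
    have "\<forall>t\<in>T. w t * (b t - r t)\<^sup>2 = 0"
      using that assms(1,2) unfolding N_def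
      by (subst (asm) sum_nonneg_eq_0_iff) (auto simp: less_imp_le)
    then show ?thesis using assms(2) by (intro sum.neutral) force
  qed
  have split: "(\<Sum>t\<in>T. w t * (f t - P t) * q t) =
      (\<Sum>t\<in>T. w t * (f t - p t) * q t) - c * (\<Sum>t\<in>T. w t * (b t - r t) * q t)" for q
    unfolding P_def sum_distrib_left sum_subtractf[symmetric]
    by (intro sum.cong) (auto simp: scaleR_fun_def algebra_simps)
  have orthB: "(\<Sum>t\<in>T. w t * (f t - P t) * q t) = 0" if "q \<in> span B" for q
    using split[of q] p(2)[OF that] r(2)[OF that] by simp
  have orthb: "(\<Sum>t\<in>T. w t * (f t - P t) * (b t - r t)) = 0"
    using split[of "\<lambda>t. b t - r t"] zero
    by (cases "N = 0") (auto simp: c_def N_def power2_eq_square mult.assoc)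
  have "P \<in> span (insert b B)"
    unfolding P_def using p(1) r(1) span_mono[OF subset_insertI, of B b]
    by (intro span_add span_scale span_diff span_base[OF insertI1]) auto
  moreover have "(\<Sum>t\<in>T. w t * (f t - P t) * q t) = 0" if q: "q \<in> span (insert b B)" for q
  proof -
    \<comment> \<open>Replacing b by \<open>(b - r) + r\<close> splits q into an element of the old
      span and a multiple of \<open>b - r\<close>, the two directions already treated.\<close>
    obtain k where "q - k *\<^sub>R b \<in> span B"
      using q unfolding span_insert by blast
    then have "q - k *\<^sub>R b + k *\<^sub>R r \<in> span B"
      using r(1) by (intro span_add span_scale)
    moreover have "q = (q - k *\<^sub>R b + k *\<^sub>R r) + k *\<^sub>R (b - r)"
      by (simp add: algebra_simps)
    ultimately obtain s where s: "s \<in> span B" "q = s + k *\<^sub>R (b - r)"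
      by blast
    have "(\<Sum>t\<in>T. w t * (f t - P t) * q t) =
        (\<Sum>t\<in>T. w t * (f t - P t) * s t) + k * (\<Sum>t\<in>T. w t * (f t - P t) * (b t - r t))"
      unfolding s(2) sum_distrib_left sum.distrib[symmetric]
      by (intro sum.cong) (auto simp: scaleR_fun_def algebra_simps)
    then show ?thesis using orthB[OF s(1)] orthb by simp
  qed
  ultimately show ?case by blast
qed

lemma weighted_pythagoras:
  fixes f :: "'a \<Rightarrow> real"
  assumes "(\<Sum>t\<in>T. w t * (f t - q t) * (q t - p t)) = 0"
  shows "(\<Sum>t\<in>T. w t * (f t - p t)\<^sup>2) =
    (\<Sum>t\<in>T. w t * (f t - q t)\<^sup>2) + (\<Sum>t\<in>T. w t * (q t - p t)\<^sup>2)"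
proof -
  have "(\<Sum>t\<in>T. w t * (f t - p t)\<^sup>2) = (\<Sum>t\<in>T. w t * (f t - q t)\<^sup>2)
      + (\<Sum>t\<in>T. w t * (q t - p t)\<^sup>2) + 2 * (\<Sum>t\<in>T. w t * (f t - q t) * (q t - p t))"
    unfolding sum_distrib_left sum.distrib[symmetric]
    by (intro sum.cong) (auto simp: power2_eq_square algebra_simps)
  then show ?thesis using assms by simp
qed

text \<open>S may exceed T because the bound is used twice: on the nodes for the mesh inequality,
  and on K for the approximation error.\<close>

lemma weighted_l2_norm_le_sup_norm:
  assumes "\<And>t. t \<in> T \<Longrightarrow> 0 \<le> w t" and "T \<subseteq> S" and "bdd_above ((\<lambda>x. \<bar>g x\<bar>) ` S)"
  shows "weighted_l2_norm T w g \<le> sqrt (\<Sum>t\<in>T. w t) * sup_norm S g"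
proof -
  have "(g t)\<^sup>2 \<le> (sup_norm S g)\<^sup>2" if "t \<in> T" for t
    using sup_norm_upper[OF assms(3), of t] that assms(2)
    by (auto simp: abs_le_square_iff[symmetric])
  then have "(\<Sum>t\<in>T. w t * (g t)\<^sup>2) \<le> (\<Sum>t\<in>T. w t) * (sup_norm S g)\<^sup>2"
    unfolding sum_distrib_right using assms(1) by (intro sum_mono mult_left_mono) auto
  then have "weighted_l2_norm T w g \<le> sqrt ((\<Sum>t\<in>T. w t) * (sup_norm S g)\<^sup>2)"
    unfolding weighted_l2_norm_def by (rule real_sqrt_le_mono)
  then show ?thesis
    using sup_norm_nonneg[OF assms(3)] by (simp add: real_sqrt_mult)
qed

text \<open>Definiteness on the polynomial space makes the minimiser unique, so that the description
  in \<open>wls_poly\<close> denotes it. The contraction is Pythagoras, with \<open>q - p\<close>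
  the projection of \<open>f - p\<close>.\<close>

lemma wls_poly_projection:
  fixes T :: "(real^'d::finite) set"
  assumes "finite T" and pos: "\<And>t. t \<in> T \<Longrightarrow> w t > 0"
    and definite: "\<And>p. p \<in> poly_space n K \<Longrightarrow> weighted_l2_norm T w p = 0 \<Longrightarrow> p = 0"
  shows "wls_poly K n T w f \<in> poly_space n K" (is ?mem)
    and "p \<in> poly_space n K \<Longrightarrow>
      weighted_l2_norm T w (wls_poly K n T w f - p) \<le> weighted_l2_norm T w (f - p)" (is "_ \<Longrightarrow> ?contr")
proof -
  let ?V = "poly_space n K" and ?N = "\<lambda>g. \<Sum>t\<in>T. w t * (g t)\<^sup>2"
  have nonneg: "0 \<le> ?N g" for g
    using pos by (intro sum_nonneg) (simp add: less_imp_le)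
  have "\<exists>q\<in>?V. \<forall>r\<in>?V. (\<Sum>t\<in>T. w t * (f t - q t) * r t) = 0"
    unfolding poly_space_eq_span
    by (intro weighted_projection_exists assms(1) pos finite_imageI finite_multi_indices)
  then obtain q where q: "q \<in> ?V" "\<And>r. r \<in> ?V \<Longrightarrow> (\<Sum>t\<in>T. w t * (f t - q t) * r t) = 0"
    by blast
  have pyth: "?N (f - p) = ?N (f - q) + ?N (q - p)" if "p \<in> ?V" for p
    using weighted_pythagoras[of w f q p T] q(2)[OF subspace_diff[OF subspace_poly_space q(1) that]]
    by simp
  have min: "?N (f - q) \<le> ?N (f - p)" and contraction: "?N (q - p) \<le> ?N (f - p)" if "p \<in> ?V" for p
    using pyth[OF that] nonneg[of "f - q"] nonneg[of "q - p"] by linarith+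
  have q_min: "is_arg_min (\<lambda>p. weighted_l2_norm T w (f - p)) (\<lambda>p. p \<in> ?V) q"
    unfolding is_arg_min_linorder weighted_l2_norm_def
    using q(1) min by (blast intro: real_sqrt_le_mono)
  have "wls_poly K n T w f = q"
    unfolding wls_poly_def
  proof (rule the_equality)
    fix r assume r: "is_arg_min (\<lambda>p. weighted_l2_norm T w (f - p)) (\<lambda>p. p \<in> ?V) r"
    then have rV: "r \<in> ?V" by (simp add: is_arg_min_linorder)
    have "weighted_l2_norm T w (f - r) \<le> weighted_l2_norm T w (f - q)"
      using r q(1) by (simp add: is_arg_min_linorder)
    then have "?N (f - r) \<le> ?N (f - q)"
      unfolding weighted_l2_norm_def by (rule real_sqrt_le_iff[THEN iffD1])
    \<comment> \<open>By Pythagoras the error of r exceeds that of q by exactly this term, so a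
      second minimiser makes it vanish.\<close>
    then have "?N (q - r) = 0"
      using pyth[OF rV] nonneg[of "q - r"] by linarith
    then have "q - r = 0"
      using rV q(1) by (intro definite subspace_diff[OF subspace_poly_space])
        (simp_all add: weighted_l2_norm_def)
    then show "r = q" by simp
  qed (rule q_min)
  then show ?mem and "p \<in> ?V \<Longrightarrow> ?contr"
    unfolding weighted_l2_norm_def using q(1) contraction
    by (simp_all only: real_sqrt_le_iff)
qed

section \<open>Caratheodory-Tchakaloff points\<close>

text \<open>Exactness is tested on the constant 1, whose sum over unit masses counts the
  points.\<close>

lemma caratheodory_tchakaloff_sum_weights:
  assumes "caratheodory_tchakaloff X \<nu> T w"
  shows "(\<Sum>t\<in>T. w t) = real (card X)"
proof -
  have "(\<Sum>x\<in>X. if x \<in> X then 1 else 0 :: real) = (\<Sum>t\<in>T. w t * (if t \<in> X then 1 else 0))"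
    using assms one_in_poly_space[of X \<nu>] unfolding caratheodory_tchakaloff_def by blast
  also have "\<dots> = (\<Sum>t\<in>T. w t)"
    using assms unfolding caratheodory_tchakaloff_def by (intro sum.cong) auto
  finally show ?thesis by simp
qed

lemma caratheodory_tchakaloff_sum_squares:
  assumes "caratheodory_tchakaloff X (2 * n) T w" and "X \<subseteq> K" and "p \<in> poly_space n K"
  shows "(\<Sum>x\<in>X. (p x)\<^sup>2) = (\<Sum>t\<in>T. w t * (p t)\<^sup>2)"
proof -
  \<comment> \<open>The square is cut off to X because exactness is stated for
    \<open>poly_space (2 * n) X\<close>; on T the cut-off changes nothing, as T lies in X.\<close>
  let ?s = "\<lambda>x. if x \<in> X then p x * p x else 0"
  have "?s \<in> poly_space (2 * n) X"
    using poly_space_mult[OF assms(3,3,2)] by (simp add: mult_2)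
  then have "(\<Sum>x\<in>X. ?s x) = (\<Sum>t\<in>T. w t * ?s t)"
    using assms(1) unfolding caratheodory_tchakaloff_def by blast
  also have "\<dots> = (\<Sum>t\<in>T. w t * (p t)\<^sup>2)"
    using assms(1) unfolding caratheodory_tchakaloff_def
    by (intro sum.cong) (auto simp: power2_eq_square)
  finally show ?thesis by (simp add: power2_eq_square)
qed

text \<open>A single square is at most the sum of all squares over X, which exactness turns into the
  weighted sum over the nodes.\<close>

lemma caratheodory_tchakaloff_sup_norm_le:
  assumes "caratheodory_tchakaloff X (2 * n) T w" and "X \<subseteq> K" and "p \<in> poly_space n K"
  shows "sup_norm X p \<le> weighted_l2_norm T w p"
proof -
  have "finite X" using assms(1) by (simp add: caratheodory_tchakaloff_def)
  have norm: "weighted_l2_norm T w p = sqrt (\<Sum>x\<in>X. (p x)\<^sup>2)"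
    by (simp add: weighted_l2_norm_def caratheodory_tchakaloff_sum_squares[OF assms])
  show ?thesis
  proof (rule sup_norm_least)
    fix x assume "x \<in> X"
    then have "(p x)\<^sup>2 \<le> (\<Sum>x\<in>X. (p x)\<^sup>2)"
      using \<open>finite X\<close> by (intro member_le_sum) auto
    then have "sqrt ((p x)\<^sup>2) \<le> sqrt (\<Sum>x\<in>X. (p x)\<^sup>2)" by (rule real_sqrt_le_mono)
    then show "\<bar>p x\<bar> \<le> weighted_l2_norm T w p" by (simp add: norm)
  qed (simp add: norm sum_nonneg)
qed

section \<open>Size and growth of the norming constants\<close>

text \<open>The constant 1 is the test function; an empty X would give 1 \<le> 0. This fixes the
  sign of C, so that inequalities may be multiplied by it.\<close>

lemma norming_constant_ge_1:
  assumes "K \<noteq> {}" and "\<And>p. p \<in> poly_space n K \<Longrightarrow> sup_norm K p \<le> C * sup_norm X p" and "X \<subseteq> K"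
  shows "1 \<le> C"
proof -
  let ?u = "\<lambda>x. if x \<in> K then 1 else 0 :: real"
  have K: "sup_norm K ?u = 1"
    using assms(1) by (auto simp: sup_norm_def cSup_eq_Max image_constant_conv cong: image_cong)
  have X: "sup_norm X ?u = (if X = {} then 0 else 1)"
    using assms(3) by (auto simp: sup_norm_def cSup_eq_Max image_constant_conv subset_iff cong: image_cong)
  show ?thesis
    using assms(2)[OF one_in_poly_space] unfolding K X by (auto split: if_splits)
qed

text \<open>The dimension is at most \<open>(n + 1) ^ CARD('d)\<close>, so a is bounded by a fixed
  power of n + 1, which every exponential of positive rate dominates.\<close>

lemma polynomial_growth_subexponential:
  assumes "a \<in> O(\<lambda>n. real (dim (poly_space n K)) powr \<beta>)" and "\<beta> \<ge> 0"
  shows "subexponential a"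
  unfolding subexponential_def
proof (intro allI impI)
  fix \<epsilon> :: real assume "\<epsilon> > 0"
  define k where "k = real CARD('a)"
  have "real (dim (poly_space n K)) powr \<beta> \<le> (real n + 1) powr (k * \<beta>)" for n
  proof -
    have "real (dim (poly_space n K)) \<le> real ((n + 1) ^ CARD('a))"
      using dim_poly_space_le[of n K] of_nat_le_iff by blast
    also have "\<dots> = (real n + 1) powr k"
      by (simp add: k_def powr_realpow add.commute)
    finally show ?thesis
      using powr_mono2[OF assms(2)] by (simp add: powr_powr[symmetric])
  qed
  then have "(\<lambda>n. real (dim (poly_space n K)) powr \<beta>) \<in> O(\<lambda>n. (real n + 1) powr (k * \<beta>))"
    by (intro bigoI[of _ 1]) auto
  also have "(\<lambda>n. (real n + 1) powr (k * \<beta>)) \<in> O(\<lambda>n. exp (\<epsilon> * real n))"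
    using \<open>\<epsilon> > 0\<close> by real_asymp
  finally show "a \<in> O(\<lambda>n. exp (\<epsilon> * real n))"
    using assms(1) landau_o.big_trans by blast
qed

section \<open>The mesh property and the error estimate\<close>

theorem proposition4:
  fixes K :: "(real^'d::finite) set"
    and A T :: "nat \<Rightarrow> (real^'d) set"
    and w :: "nat \<Rightarrow> real^'d \<Rightarrow> real"
    and C :: real
  assumes "compact K"
    and "polynomial_mesh K A C"
    and "\<And>n. card (A n) > dim (poly_space (2 * n) K)"
    and "\<And>n. caratheodory_tchakaloff (A n) (2 * n) (T n) (w n)"
    and "\<And>n. card (T n) \<le> dim (poly_space (2 * n) K)"
  shows "weakly_admissible_mesh K T (\<lambda>n. C * sqrt (real (card (A n)))) \<and>
    (\<forall>n f. continuous_on K f \<longrightarrow>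
      sup_norm K (f - wls_poly K n (T n) (w n) f)
        \<le> (1 + C * sqrt (real (card (A n)))) * (INF p\<in>poly_space n K. sup_norm K (f - p)))"
proof -
  have A: "finite (A n)" "A n \<subseteq> K"
    and mesh: "\<And>p. p \<in> poly_space n K \<Longrightarrow> sup_norm K p \<le> C * sup_norm (A n) p" for n
    using assms(2) by (auto simp: polynomial_mesh_def norming_mesh_def)
  obtain \<beta> where \<beta>: "\<beta> \<ge> 1"
    "(\<lambda>n. real (card (A n))) \<in> O(\<lambda>n. real (dim (poly_space n K)) powr \<beta>)"
    using assms(2) by (auto simp: polynomial_mesh_def norming_mesh_def)
  have T: "T n \<subseteq> A n" "finite (T n)" "\<And>t. t \<in> T n \<Longrightarrow> w n t > 0" for n
    using assms(4)[of n] A(1)[of n] by (auto simp: caratheodory_tchakaloff_def intro: finite_subset)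
  have TK: "T n \<subseteq> K" for n
    using T(1) A(2) by blast
  \<comment> \<open>A cardinality above a dimension is positive; the mesh point obtained also shows
    that K is nonempty.\<close>
  have "A 0 \<noteq> {}"
    using assms(3)[of 0] by auto
  then have "C \<ge> 1"
    using A(2) mesh by (intro norming_constant_ge_1[of K 0 C "A 0"]) auto
  have bdd_poly: "bdd_above ((\<lambda>x. \<bar>p x\<bar>) ` K)" if "p \<in> poly_space n K" for n p
    using continuous_on_compact_bdd_abs[OF assms(1) poly_space_continuous_on[OF that]] .
  \<comment> \<open>The mesh inequality is followed by the passage from the mesh to the weighted
    norm on the nodes.\<close>
  have norm_K: "sup_norm K p \<le> C * weighted_l2_norm (T n) (w n) p" if "p \<in> poly_space n K" for n p
    using mesh[OF that] \<open>C \<ge> 1\<close>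
      mult_left_mono[OF caratheodory_tchakaloff_sup_norm_le[OF assms(4) A(2) that], of C]
    by linarith
  \<comment> \<open>The square root is that of the total weight, which equals the number of mesh
    points.\<close>
  have norm_w: "C * weighted_l2_norm (T n) (w n) g \<le> C * sqrt (real (card (A n))) * sup_norm S g"
    if "T n \<subseteq> S" "bdd_above ((\<lambda>x. \<bar>g x\<bar>) ` S)" for n g S
    using weighted_l2_norm_le_sup_norm[of "T n" "w n" S g] that T(3)[of _ n] \<open>C \<ge> 1\<close>
      caratheodory_tchakaloff_sum_weights[OF assms(4)[of n]]
    by (simp add: less_imp_le)
  have norming: "norming_mesh K T (\<lambda>n. C * sqrt (real (card (A n))))"
    unfolding norming_mesh_def
  proof (intro conjI allI ballI)
    fix n p assume "p \<in> poly_space n K"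
    then show "sup_norm K p \<le> C * sqrt (real (card (A n))) * sup_norm (T n) p"
      using norm_K norm_w[of n "T n" p] T(2) by fastforce
  next
    \<comment> \<open>The nodes are a subset of the mesh and inherit its growth exponent.\<close>
    have "(\<lambda>n. real (card (T n))) \<in> O(\<lambda>n. real (card (A n)))"
      using card_mono[OF A(1) T(1)] by (intro bigoI[of _ 1]) auto
    then have "(\<lambda>n. real (card (T n))) \<in> O(\<lambda>n. real (dim (poly_space n K)) powr \<beta>)"
      using \<beta>(2) landau_o.big_trans by blast
    then show "\<exists>\<beta>\<ge>1. (\<lambda>n. real (card (T n))) \<in> O(\<lambda>n. real (dim (poly_space n K)) powr \<beta>)"
      using \<beta>(1) by blast
  qed (use T TK in auto)
  \<comment> \<open>The new constants are therefore at most C times the mesh cardinality, and the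
    exponent \<beta> of the mesh bounds their growth too.\<close>
  have "sqrt (real m) \<le> real m" for m
    by (rule real_le_lsqrt) (auto simp: power2_eq_square simp flip: of_nat_mult)
  then have "(\<lambda>n. C * sqrt (real (card (A n)))) \<in> O(\<lambda>n. real (card (A n)))"
    using \<open>C \<ge> 1\<close> by (intro bigoI[of _ C]) (auto simp: abs_mult)
  then have "(\<lambda>n. C * sqrt (real (card (A n)))) \<in> O(\<lambda>n. real (dim (poly_space n K)) powr \<beta>)"
    using \<beta>(2) landau_o.big_trans by blast
  then have "subexponential (\<lambda>n. C * sqrt (real (card (A n))))"
    using \<beta>(1) by (intro polynomial_growth_subexponential) auto
  moreover have "sup_norm K (f - wls_poly K n (T n) (w n) f)
      \<le> (1 + C * sqrt (real (card (A n)))) * (INF p\<in>poly_space n K. sup_norm K (f - p))"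
    if f: "continuous_on K f" for n f
  proof -
    define L where "L = wls_poly K n (T n) (w n) f"
    \<comment> \<open>A vanishing weighted norm forces p to vanish on K by \<open>norm_K\<close>;
      outside K it is zero by the encoding, so p is the zero function.\<close>
    have definite: "p = 0" if p: "p \<in> poly_space n K" "weighted_l2_norm (T n) (w n) p = 0" for p
    proof
      fix x
      have "sup_norm K p \<le> 0" using norm_K[OF p(1)] p(2) by simp
      then show "p x = 0 x"
        using sup_norm_upper[OF bdd_poly[OF p(1)], of x] poly_space_outside[OF p(1), of x]
        by fastforce
    qed
    have L: "L \<in> poly_space n K"
      unfolding L_def by (rule wls_poly_projection(1)[OF T(2,3) definite])
    have bdd_diff: "bdd_above ((\<lambda>x. \<bar>(f - p) x\<bar>) ` K)" if "p \<in> poly_space n K" for p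
      using f poly_space_continuous_on[OF that] unfolding minus_apply
      by (intro continuous_on_compact_bdd_abs assms(1) continuous_on_diff)
    define c where "c = 1 + C * sqrt (real (card (A n)))"
    have "c > 0"
      using \<open>C \<ge> 1\<close> by (simp add: c_def add_pos_nonneg)
    \<comment> \<open>The error splits as \<open>f - L = (f - p) - (L - p)\<close>. The second part
      is a polynomial, so its norm on K passes to the weighted norm, where the projection contracts
      it to \<open>f - p\<close>, and back to the supremum norm on K.\<close>
    have "sup_norm K (f - L) \<le> c * sup_norm K (f - p)" if p: "p \<in> poly_space n K" for p
    proof -
      have Lp: "L - p \<in> poly_space n K"
        by (rule subspace_diff[OF subspace_poly_space L p])
      have "sup_norm K (L - p) \<le> C * weighted_l2_norm (T n) (w n) (L - p)"
        by (rule norm_K[OF Lp])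
      also have "\<dots> \<le> C * weighted_l2_norm (T n) (w n) (f - p)"
        unfolding L_def using \<open>C \<ge> 1\<close>
        by (intro mult_left_mono wls_poly_projection(2) T(2,3) definite p) auto
      also have "\<dots> \<le> C * sqrt (real (card (A n))) * sup_norm K (f - p)"
        by (rule norm_w[OF TK bdd_diff[OF p]])
      finally have Lp_le: "sup_norm K (L - p) \<le> C * sqrt (real (card (A n))) * sup_norm K (f - p)" .
      show ?thesis
      proof (rule sup_norm_least)
        show "0 \<le> c * sup_norm K (f - p)"
          by (intro mult_nonneg_nonneg sup_norm_nonneg bdd_diff p less_imp_le \<open>c > 0\<close>)
        fix x assume "x \<in> K"
        then have "\<bar>(f - p) x\<bar> \<le> sup_norm K (f - p)" "\<bar>(L - p) x\<bar> \<le> sup_norm K (L - p)"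
          using sup_norm_upper[OF bdd_diff[OF p]] sup_norm_upper[OF bdd_poly[OF Lp]] by blast+
        moreover have "\<bar>(f - L) x\<bar> \<le> \<bar>(f - p) x\<bar> + \<bar>(L - p) x\<bar>"
          by simp
        ultimately show "\<bar>(f - L) x\<bar> \<le> c * sup_norm K (f - p)"
          using Lp_le unfolding c_def distrib_right by linarith
      qed
    qed
    \<comment> \<open>Dividing by c > 0 gives a lower bound uniform in p, hence one for the infimum;
      L witnesses that the infimum is over a nonempty set.\<close>
    then have "sup_norm K (f - L) / c \<le> (INF p\<in>poly_space n K. sup_norm K (f - p))"
      using \<open>c > 0\<close> L by (intro cINF_greatest) (auto simp: field_simps)
    then show ?thesis
      using \<open>c > 0\<close> unfolding L_def c_def by (simp add: field_simps)
  qed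
  ultimately show ?thesis
    using norming by (simp add: weakly_admissible_mesh_def)
qed

end
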